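(* There exists a testing algorithm for monotonicity of distributions over $[n]$ in the ${\sf COND}$ model whose query complexity is $\tilde{O}(1/\varepsilon^{22})$ (in particular, independent of $n$). That is, there is a randomized algorithm which, given $n$, $\varepsilon\in(0,1]$ and ${\sf COND}$ oracle access to an unknown distribution $D$ over $[n]$, makes $\tilde{O}(1/\varepsilon^{22})$ oracle calls and outputs ACCEPT with probability at least $2/3$ if $D$ is monotone, and outputs REJECT with probability at least $2/3$ if $d_{TV}(D,\mathcal{M})\ge\varepsilon$.
   Context: A distribution $D$ over $[n]=\{1,\dots,n\}$ is a non-negative function with $\sum_i D(i)=1$; $D(S)=\sum_{x\in S}D(x)$. It is monotone if $D(1)\ge D(2)\ge\dots\ge D(n)$; $\mathcal{M}$ denotes the class of monotone distributions over $[n]$. Total variation distance: $d_{TV}(D_1,D_2)=\frac12\sum_{x}|D_1(x)-D_2(x)|$, and $d_{TV}(D,\mathcal{M})=\inf_{D'\in\mathcal{M}}d_{TV}(D,D')$. A ${\sf COND}$ oracle for $D$ takes as input any set $S\subseteq[n]$ with $D(S)>0$ and returns an element $i\in S$ with probability $D(i)/D(S)$, independently of all previous calls. $\tilde{O}(\cdot)$ hides polylogarithmic factors in its argument; constants are absolute. *)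

theory Defs
  imports "HOL-Probability.Probability" "HOL-Library.Extended_Nat"
begin

definition distributions :: "nat \<Rightarrow> nat pmf set" where
  "distributions n = {D. set_pmf D \<subseteq> {1..n}}"

definition monotone_distributions :: "nat \<Rightarrow> nat pmf set" where
  "monotone_distributions n =
     {D \<in> distributions n. \<forall>i\<in>{1..n}. \<forall>j\<in>{1..n}. i \<le> j \<longrightarrow> pmf D j \<le> pmf D i}"

definition d_TV :: "nat \<Rightarrow> nat pmf \<Rightarrow> nat pmf \<Rightarrow> real" where
  "d_TV n D1 D2 = (\<Sum>x\<in>{1..n}. \<bar>pmf D1 x - pmf D2 x\<bar>) / 2"

definition d_TV_class :: "nat \<Rightarrow> nat pmf \<Rightarrow> nat pmf set \<Rightarrow> real" where
  "d_TV_class n D C = (INF D'\<in>C. d_TV n D D')"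

text \<open>
  A randomized adaptive algorithm with access to a conditional sampling oracle. Every run stops with
  a result after finitely many steps; a step is either a draw from a distribution chosen
  by the algorithm (its own coins) or one oracle call on a set, and the continuation depends on
  the value obtained. The unknown distribution is not a parameter: it enters only through the
  answers to oracle calls.
\<close>

datatype 'r cond_alg =
    Return 'r
  | Coins "nat pmf" "nat \<Rightarrow> 'r cond_alg"
  | Query "nat set" "nat \<Rightarrow> 'r cond_alg"

text \<open>
  Output distribution when the oracle is for \<open>D\<close>. The library constant \<open>cond_pmf\<close> is unspecified
  when \<open>S\<close> has probability zero; \<open>legal\<close> below excludes such calls.
\<close>

primrec run :: "nat pmf \<Rightarrow> 'r cond_alg \<Rightarrow> 'r pmf" where
  "run D (Return r) = return_pmf r"
| "run D (Coins p f) = bind_pmf p (\<lambda>x. run D (f x))"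
| "run D (Query S f) = bind_pmf (cond_pmf D S) (\<lambda>i. run D (f i))"

text \<open>
  With oracle for \<open>D\<close>, every oracle call in every run of positive probability is on a
  subset of \<open>{1..n}\<close> of positive mass, i.e. on an admissible oracle input.
\<close>

primrec legal :: "nat \<Rightarrow> nat pmf \<Rightarrow> 'r cond_alg \<Rightarrow> bool" where
  "legal n D (Return r) \<longleftrightarrow> True"
| "legal n D (Coins p f) \<longleftrightarrow> (\<forall>x\<in>set_pmf p. legal n D (f x))"
| "legal n D (Query S f) \<longleftrightarrow>
     S \<subseteq> {1..n} \<and> measure_pmf.prob D S > 0 \<and> (\<forall>i\<in>S \<inter> set_pmf D. legal n D (f i))"

text \<open>
  Worst-case number of oracle calls over all runs of positive probability with oracle for \<open>D\<close>.
\<close>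

primrec queries :: "nat pmf \<Rightarrow> 'r cond_alg \<Rightarrow> enat" where
  "queries D (Return r) = 0"
| "queries D (Coins p f) = (SUP x\<in>set_pmf p. queries D (f x))"
| "queries D (Query S f) = eSuc (SUP i\<in>S \<inter> set_pmf D. queries D (f i))"

datatype verdict = ACCEPT | REJECT

text \<open>
  Soft-O on a parameter range \<open>X\<close>, for \<open>g \<ge> 1\<close>: an upper bound by \<open>g\<close> times a polylogarithm
  of \<open>g\<close>, with constants uniform over \<open>X\<close>. The offset in the logarithm keeps the
  bound nontrivial where \<open>g x = 1\<close>.
\<close>

definition soft_O :: "'a set \<Rightarrow> ('a \<Rightarrow> real) \<Rightarrow> ('a \<Rightarrow> real) set" where
  "soft_O X g = {f. \<exists>(C::real) (k::nat). \<forall>x\<in>X. \<bar>f x\<bar> \<le> C * g x * ln (2 + g x) ^ k}"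

end

(*
  Draw y from D and x uniformly from {1..<y}, and compare D x with D y by repeated oracle calls
  on {x, y}. For monotone D the answer y has probability at most 1/2. If D is eps-far from monotone,
  then the expectation of max 0 (1 - D x / D y) is at least eps^2 / 2, whatever n is, so that some
  of O(1 / eps^2) pairs is detected with O(1 / eps^6) calls each.

  For the expectation, let t be uniform in [0, D y], so that y is uniform in the level set
  S = {D >= t}, and let e be the number of elements of S beyond k = card S. Each such element is
  preceded by a fraction of at least e / (2 k) non-members of S, so D x < D y is detected at level t
  with probability at least (e / k)^2 / 2. The decreasing rearrangement of D shows that e / k is
  at least eps on average.
*)

theory Submission
  imports Defs "HOL-Probability.Hoeffding"
begin

section \<open>Level sets\<close>

text \<open>The weight of a value is its gap to the next smaller value of \<open>V\<close>, or the
  value itself at the minimum, so that the sums telescope.\<close>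

lemma ex_layer_weights:
  fixes V :: "real set"
  assumes "finite V" "\<forall>v\<in>V. 0 \<le> v"
  shows "\<exists>w. (\<forall>v\<in>V. 0 \<le> w v) \<and> (\<forall>a\<in>V. (\<Sum>v | v \<in> V \<and> v \<le> a. w v) = a)"
  using assms
proof (induction rule: finite_linorder_max_induct)
  case empty
  then show ?case by simp
next
  case (insert b V)
  then obtain w where w: "\<forall>v\<in>V. 0 \<le> w v" "\<And>a. a \<in> V \<Longrightarrow> (\<Sum>v | v \<in> V \<and> v \<le> a. w v) = a"
    by auto
  have bV: "b \<notin> V" using insert.hyps by auto
  define s where "s = sum w V"
  \<comment> \<open>The total weight so far is the largest value below \<open>b\<close>, or 0, so
    the new gap is non-negative.\<close>
  have s: "s \<le> b"
  proof (cases "V = {}")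
    case True
    then show ?thesis using insert.prems by (simp add: s_def)
  next
    case False
    then have "{v \<in> V. v \<le> Max V} = V" using insert.hyps by auto
    then have "s = Max V" using w(2)[of "Max V"] False insert.hyps by (simp add: s_def)
    then show ?thesis using False insert.hyps by (auto intro: less_imp_le)
  qed
  define w' where "w' = w(b := b - s)"
  have "(\<Sum>v | v \<in> insert b V \<and> v \<le> a. w' v) = a" if "a \<in> insert b V" for a
  proof (cases "a = b")
    case True
    then have "{v. v \<in> insert b V \<and> v \<le> a} = insert b V" using insert.hyps by auto
    moreover have "sum w' V = s" unfolding s_def w'_def using bV by (intro sum.cong) auto
    ultimately show ?thesis using bV insert.hyps True by (simp add: w'_def)
  next
    case False
    then have a: "a \<in> V" using that by auto
    then have "{v. v \<in> insert b V \<and> v \<le> a} = {v. v \<in> V \<and> v \<le> a}" using insert.hyps by auto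
    moreover have "sum w' {v. v \<in> V \<and> v \<le> a} = sum w {v. v \<in> V \<and> v \<le> a}"
      unfolding w'_def using bV by (intro sum.cong) auto
    ultimately show ?thesis using w(2)[OF a] by simp
  qed
  moreover have "\<forall>v\<in>insert b V. 0 \<le> w' v" using w(1) s by (simp add: w'_def)
  ultimately show ?case by blast
qed

text \<open>Finite form of integrating the indicator of t <= f x over t: the only levels are the
  values of \<open>f\<close> on \<open>A\<close>, weighted by their gaps.\<close>

lemma layer_cake:
  fixes f :: "'a \<Rightarrow> real"
  assumes "finite A" "\<And>x. x \<in> A \<Longrightarrow> 0 \<le> f x"
  obtains V w where "finite V" "\<And>v. v \<in> V \<Longrightarrow> 0 \<le> w v"
    "\<And>x. x \<in> A \<Longrightarrow> f x = (\<Sum>v\<in>V. w v * of_bool (v \<le> f x))"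
proof -
  obtain w where w: "\<forall>v\<in>f ` A. 0 \<le> w v" "\<And>a. a \<in> f ` A \<Longrightarrow> (\<Sum>v | v \<in> f ` A \<and> v \<le> a. w v) = a"
    using ex_layer_weights[of "f ` A"] assms by auto
  have "f x = (\<Sum>v\<in>f ` A. w v * of_bool (v \<le> f x))" if "x \<in> A" for x
  proof -
    have "(\<Sum>v\<in>f ` A. w v * of_bool (v \<le> f x)) = (\<Sum>v | v \<in> f ` A \<and> v \<le> f x. w v)"
      using assms(1) by (intro sum.mono_neutral_cong_right) auto
    then show ?thesis using w(2)[of "f x"] that by simp
  qed
  then show thesis using that[of "f ` A" w] w(1) assms(1) by auto
qed

text \<open>Both sets have the same cardinality and lose the same intersection.\<close>

lemma card_diff_initial_segment:
  assumes "S \<subseteq> {1..n}"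
  shows "card ({1..card S} - S) = card (S - {1..card S})"
proof -
  have fin: "finite S" using assms finite_subset by blast
  have "card ({1..card S} - S) = card {1..card S} - card ({1..card S} \<inter> S)"
    by (intro card_Diff_subset_Int) auto
  moreover have "card (S - {1..card S}) = card S - card (S \<inter> {1..card S})"
    using fin by (intro card_Diff_subset_Int) auto
  ultimately show ?thesis by (simp add: Int_commute)
qed

text \<open>The sum counts the symmetric difference of \<open>S\<close> and the initial segment,
  whose two halves have equal size.\<close>

lemma sum_abs_diff_initial_segment:
  assumes "S \<subseteq> {1..n}"
  shows "(\<Sum>x\<in>{1..n}. \<bar>of_bool (x \<in> S) - of_bool (x \<le> card S)\<bar>) = 2 * real (card (S - {1..card S}))"
proof -
  have fin: "finite S" using assms finite_subset by blast
  have kn: "card S \<le> n" using card_mono[OF _ assms] by simp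
  have "(\<Sum>x\<in>{1..n}. \<bar>of_bool (x \<in> S) - of_bool (x \<le> card S)\<bar>)
      = (\<Sum>x\<in>{1..n}. (of_bool (x \<in> S - {1..card S}) + of_bool (x \<in> {1..card S} - S) :: real))"
    by (intro sum.cong) auto
  also have "\<dots> = real (card (S - {1..card S})) + real (card ({1..card S} - S))"
  proof -
    have "{1..n} \<inter> (S - {1..card S}) = S - {1..card S}"
         "{1..n} \<inter> ({1..card S} - S) = {1..card S} - S" using assms kn by auto
    then show ?thesis unfolding sum.distrib
      by (simp add: of_bool_def sum.If_cases del: Diff_iff atLeastAtMost_iff)
  qed
  finally show ?thesis using card_diff_initial_segment[OF assms] by simp
qed

text \<open>
  An element y of S beyond its cardinality k is preceded by at least e non-members of S, and by
  at least y - k of them, so they make up at least a fraction e / (2 k) of the predecessors of y.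
\<close>

lemma fraction_nonmembers_below:
  assumes S: "S \<subseteq> {1..n}" and y: "y \<in> S - {1..card S}"
  shows "real (card (S - {1..card S})) / (2 * real (card S)) \<le> real (card ({1..<y} - S)) / real (y - 1)"
proof -
  define k where "k = card S"
  define e where "e = card (S - {1..k})"
  define f where "f = card ({1..<y} - S)"
  have fin: "finite S" using S finite_subset by blast
  have yS: "y \<in> S" and yk: "k < y" using y S by (auto simp: k_def)
  have k: "1 \<le> k" unfolding k_def using fin yS by (metis One_nat_def Suc_leI card_gt_0_iff empty_iff)
  have ek: "e \<le> k" unfolding e_def k_def using fin by (intro card_mono) auto
  \<comment> \<open>All non-members of \<open>S\<close> in \<open>{1..k}\<close> lie below
    \<open>y\<close>, and there are \<open>e\<close> of them.\<close>
  have "e \<le> f" unfolding e_def f_def k_def card_diff_initial_segment[OF S, symmetric]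
    using yk by (intro card_mono) (auto simp: k_def)
  \<comment> \<open>At most \<open>k - 1\<close> predecessors of \<open>y\<close> are in
    \<open>S\<close>, since \<open>y\<close> itself is a member.\<close>
  moreover have "y \<le> f + k"
  proof -
    have "card ({1..<y} \<inter> S) \<le> card (S - {y})" using fin by (intro card_mono) auto
    also have "\<dots> = k - 1" using yS by (simp add: k_def)
    finally have "card ({1..<y} \<inter> S) \<le> k - 1" .
    moreover have "card {1..<y} = card ({1..<y} \<inter> S) + f"
      unfolding f_def by (rule card_Int_Diff) simp
    ultimately show ?thesis using k by simp
  qed
  \<comment> \<open>In \<open>e * (f + k)\<close> the product \<open>e * k\<close> is at most
    \<open>f * k\<close>; with \<open>e \<le> k\<close> this becomes the claim without
    denominators.\<close>
  ultimately have "e * (y - 1) \<le> e * f + k * f"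
  proof -
    assume "e \<le> f" "y \<le> f + k"
    have "e * (y - 1) \<le> e * (f + k)" using \<open>y \<le> f + k\<close> by (intro mult_le_mono) auto
    also have "\<dots> \<le> e * f + k * f" using \<open>e \<le> f\<close> by (simp add: algebra_simps)
    finally show ?thesis .
  qed
  also have "\<dots> \<le> 2 * k * f" using ek by (simp add: algebra_simps)
  finally have "real e * real (y - 1) \<le> 2 * real k * real f"
    by (metis of_nat_le_iff of_nat_mult of_nat_numeral)
  then show ?thesis using k yk unfolding k_def[symmetric] e_def[symmetric] f_def[symmetric]
    by (simp add: field_simps)
qed

text \<open>
  The bound is the tangent form of e^2 / (2 k) with slope t, which is additive over level sets.
\<close>

lemma sum_fraction_nonmembers_below:
  assumes S: "S \<subseteq> {1..n}"
  shows "t * real (card (S - {1..card S})) - t\<^sup>2 * real (card S) / 2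
    \<le> (\<Sum>y\<in>{1..n}. \<Sum>x\<in>{1..<y}. of_bool (y \<in> S \<and> x \<notin> S) / real (y - 1))"
proof -
  define k where "k = real (card S)"
  define e where "e = real (card (S - {1..card S}))"
  have fin: "finite S" using S finite_subset by blast
  \<comment> \<open>Cleared of denominators, this says that the square of \<open>e - t * k\<close>
    is non-negative; for empty \<open>S\<close> both sides are 0.\<close>
  have "t * e - t\<^sup>2 * k / 2 \<le> e * (e / (2 * k))"
  proof (cases "card S = 0")
    case True
    then show ?thesis using fin by (simp add: e_def k_def)
  next
    case False
    then have "0 < k" by (simp add: k_def)
    have "0 \<le> (e - t * k)\<^sup>2" by simp
    also have "\<dots> = (e * (e / (2 * k)) - (t * e - t\<^sup>2 * k / 2)) * (2 * k)" using \<open>0 < k\<close>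
      by (simp add: power2_eq_square field_simps)
    finally show ?thesis using \<open>0 < k\<close> by (simp add: zero_le_mult_iff)
  qed
  also have "\<dots> = (\<Sum>y\<in>S - {1..card S}. e / (2 * k))" by (simp add: e_def)
  also have "\<dots> \<le> (\<Sum>y\<in>S - {1..card S}. real (card ({1..<y} - S)) / real (y - 1))"
    unfolding e_def k_def by (intro sum_mono fraction_nonmembers_below[OF S])
  also have "\<dots> \<le> (\<Sum>y\<in>S. real (card ({1..<y} - S)) / real (y - 1))"
    using fin by (intro sum_mono2) auto
  also have "\<dots> = (\<Sum>y\<in>{1..n}. of_bool (y \<in> S) * (real (card ({1..<y} - S)) / real (y - 1)))"
    using S by (intro sum.mono_neutral_cong_left) auto
  also have "\<dots> = (\<Sum>y\<in>{1..n}. \<Sum>x\<in>{1..<y}. of_bool (y \<in> S \<and> x \<notin> S) / real (y - 1))"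
  proof (intro sum.cong refl)
    fix y
    have "real (card ({1..<y} - S)) = (\<Sum>x\<in>{1..<y}. of_bool (x \<notin> S))"
      by (simp add: of_bool_def sum.If_cases Diff_eq Collect_neg_eq)
    then show "of_bool (y \<in> S) * (real (card ({1..<y} - S)) / real (y - 1))
        = (\<Sum>x\<in>{1..<y}. of_bool (y \<in> S \<and> x \<notin> S) / real (y - 1))"
      by (simp only: sum_divide_distrib sum_distrib_left of_bool_conj times_divide_eq_right)
  qed
  finally show ?thesis by (simp add: e_def k_def)
qed

section \<open>Distance to monotonicity\<close>

text \<open>The expectation of max 0 (1 - D x / D y) for y drawn from D and x uniform below y;
  multiplying by D y avoids the quotient. The inner sum is empty for y = 1.\<close>

definition violation_mass :: "nat \<Rightarrow> nat pmf \<Rightarrow> real" where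
  "violation_mass n D =
     (\<Sum>y\<in>{1..n}. \<Sum>x\<in>{1..<y}. max 0 (pmf D y - pmf D x) / real (y - 1))"

lemma sum_pmf_distributions:
  assumes "D \<in> distributions n"
  shows "(\<Sum>x\<in>{1..n}. pmf D x) = 1"
  using assms by (intro sum_pmf_eq_1) (auto simp: distributions_def)

lemma ex_pmf_of_weights:
  assumes "finite A" "\<And>x. 0 \<le> f x" "\<And>x. x \<notin> A \<Longrightarrow> f x = 0" "(\<Sum>x\<in>A. f x) = 1"
  obtains p where "pmf p = f"
proof -
  have "(\<integral>\<^sup>+ x. ennreal (f x) \<partial>count_space UNIV) = (\<Sum>x\<in>A. ennreal (f x))"
    using assms by (intro nn_integral_count_space') auto
  also have "\<dots> = 1" using assms by (subst sum_ennreal) auto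
  finally have "pmf (embed_pmf f) = f" using assms by (intro ext pmf_embed_pmf) auto
  then show thesis by (rule that)
qed

text \<open>
  The monotone distribution used for comparison is the decreasing rearrangement: every level set
  is replaced by the initial segment of the same cardinality.
\<close>

lemma violation_mass_ge:
  assumes D: "D \<in> distributions n" and t: "0 \<le> t" "t \<le> d_TV_class n D (monotone_distributions n)"
  shows "t\<^sup>2 / 2 \<le> violation_mass n D"
proof -
  obtain V w where V: "finite V" and w: "\<And>v. v \<in> V \<Longrightarrow> 0 \<le> w v"
    and lc: "\<And>x. x \<in> {1..n} \<Longrightarrow> pmf D x = (\<Sum>v\<in>V. w v * of_bool (v \<le> pmf D x))"
    using layer_cake[of "{1..n}" "pmf D"] by auto
  define S where "S v = {x\<in>{1..n}. v \<le> pmf D x}" for v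
  define k where "k v = card (S v)" for v
  define e where "e v = real (card (S v - {1..k v}))" for v
  have S: "S v \<subseteq> {1..n}" for v by (auto simp: S_def)
  have kn: "k v \<le> n" for v using card_mono[OF _ S[of v]] by (simp add: k_def)
  have lcS: "pmf D x = (\<Sum>v\<in>V. w v * of_bool (x \<in> S v))" if "x \<in> {1..n}" for x
    using lc[OF that] that by (simp add: S_def)
  \<comment> \<open>Double counting of the pairs of a level and an element of its level set.\<close>
  have wk: "(\<Sum>v\<in>V. w v * real (k v)) = 1"
  proof -
    have "(\<Sum>v\<in>V. w v * real (k v)) = (\<Sum>v\<in>V. \<Sum>x\<in>{1..n}. w v * of_bool (x \<in> S v))"
      using S by (simp add: sum_distrib_left[symmetric] of_bool_def sum.If_cases k_def Int_absorb1)
    also have "\<dots> = (\<Sum>x\<in>{1..n}. pmf D x)" by (subst sum.swap) (simp add: lcS)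
    finally show ?thesis using sum_pmf_distributions[OF D] by simp
  qed
  define f where "f x = (\<Sum>v\<in>V. w v * of_bool (x \<in> {1..k v}))" for x
  have "(\<Sum>x\<in>{1..n}. f x) = (\<Sum>v\<in>V. \<Sum>x\<in>{1..n}. w v * of_bool (x \<in> {1..k v}))"
    unfolding f_def by (rule sum.swap)
  also have "\<dots> = (\<Sum>v\<in>V. w v * real (k v))"
  proof (intro sum.cong refl)
    fix v
    have "{1..n} \<inter> {1..k v} = {1..k v}" using kn[of v] by auto
    then show "(\<Sum>x\<in>{1..n}. w v * of_bool (x \<in> {1..k v})) = w v * real (k v)"
      by (simp add: sum_distrib_left[symmetric] of_bool_def sum.If_cases
          del: atLeastAtMost_iff Int_atLeastAtMost)
  qed
  finally have "(\<Sum>x\<in>{1..n}. f x) = 1" using wk by simp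
  moreover have f0: "f x = 0" if "x \<notin> {1..n}" for x
    unfolding f_def using that kn by (intro sum.neutral) (auto intro: order_trans)
  moreover have "0 \<le> f x" for x unfolding f_def using w by (intro sum_nonneg) auto
  ultimately obtain D' where D': "pmf D' = f"
    using ex_pmf_of_weights[of "{1..n}" f] by blast
  have "D' \<in> monotone_distributions n"
    unfolding monotone_distributions_def distributions_def
  proof (intro CollectI conjI ballI impI)
    show "set_pmf D' \<subseteq> {1..n}" using f0 by (metis D' set_pmf_iff subsetI)
    fix i j assume "i \<in> {1..n}" "j \<in> {1..n}" "i \<le> j"
    then show "pmf D' j \<le> pmf D' i" unfolding D' f_def using w
      by (intro sum_mono mult_left_mono) auto
  qed
  then have "d_TV_class n D (monotone_distributions n) \<le> d_TV n D D'"
    unfolding d_TV_class_def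
    by (intro cINF_lower bdd_belowI[of _ 0]) (auto simp: d_TV_def intro!: sum_nonneg)
  also have "d_TV n D D' \<le> (\<Sum>x\<in>{1..n}. \<Sum>v\<in>V. w v * \<bar>of_bool (x \<in> S v) - of_bool (x \<le> k v)\<bar>) / 2"
    unfolding d_TV_def
  proof (intro divide_right_mono sum_mono)
    fix x assume x: "x \<in> {1..n}"
    have "\<bar>pmf D x - pmf D' x\<bar> = \<bar>\<Sum>v\<in>V. w v * (of_bool (x \<in> S v) - of_bool (x \<le> k v))\<bar>"
      using x by (simp add: lcS D' f_def sum_subtractf algebra_simps)
    also have "\<dots> \<le> (\<Sum>v\<in>V. w v * \<bar>of_bool (x \<in> S v) - of_bool (x \<le> k v)\<bar>)"
      by (rule order_trans[OF sum_abs]) (use w in \<open>auto simp: abs_mult intro!: sum_mono\<close>)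
    finally show "\<bar>pmf D x - pmf D' x\<bar> \<le> \<dots>" .
  qed simp
  also have "\<dots> = (\<Sum>v\<in>V. w v * e v)"
    by (subst sum.swap) (simp add: sum_distrib_left[symmetric] sum_abs_diff_initial_segment[OF S, simplified]
        k_def e_def sum_divide_distrib)
  finally have "t \<le> (\<Sum>v\<in>V. w v * e v)" using t by simp
  then have "t * t \<le> t * (\<Sum>v\<in>V. w v * e v)" using t by (intro mult_left_mono)
  \<comment> \<open>Convexity by a tangent: the weights \<open>w v * real (k v)\<close> sum to 1 and
    the average of e / k is at least t, so the tangent at t suffices.\<close>
  then have "t\<^sup>2 / 2 \<le> t * (\<Sum>v\<in>V. w v * e v) - t\<^sup>2 / 2 * (\<Sum>v\<in>V. w v * real (k v))"
    using wk by (simp add: power2_eq_square)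
  also have "\<dots> = (\<Sum>v\<in>V. w v * (t * e v - t\<^sup>2 * real (k v) / 2))"
    by (simp add: sum_distrib_left sum_subtractf algebra_simps)
  also have "\<dots> \<le> (\<Sum>v\<in>V. w v * (\<Sum>y\<in>{1..n}. \<Sum>x\<in>{1..<y}. of_bool (y \<in> S v \<and> x \<notin> S v) / real (y - 1)))"
    using w sum_fraction_nonmembers_below[OF S]
    by (intro sum_mono mult_left_mono) (auto simp: e_def k_def)
  also have "\<dots> = (\<Sum>v\<in>V. \<Sum>y\<in>{1..n}. \<Sum>x\<in>{1..<y}. w v * of_bool (y \<in> S v \<and> x \<notin> S v) / real (y - 1))"
    by (simp add: sum_distrib_left)
  also have "\<dots> = (\<Sum>y\<in>{1..n}. \<Sum>v\<in>V. \<Sum>x\<in>{1..<y}. w v * of_bool (y \<in> S v \<and> x \<notin> S v) / real (y - 1))"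
    by (rule sum.swap)
  also have "\<dots> = (\<Sum>y\<in>{1..n}. \<Sum>x\<in>{1..<y}. (\<Sum>v\<in>V. w v * of_bool (y \<in> S v \<and> x \<notin> S v)) / real (y - 1))"
    unfolding sum_divide_distrib by (intro sum.cong refl sum.swap)
  also have "\<dots> \<le> violation_mass n D"
    unfolding violation_mass_def
  proof (intro sum_mono divide_right_mono)
    fix y x assume yx: "y \<in> {1..n}" "x \<in> {1..<y}"
    then have x: "x \<in> {1..n}" by auto
    \<comment> \<open>Level sets are nested, so a level separates y from x only if D x < D y, and
      the separating levels then have total weight D y - D x.\<close>
    show "(\<Sum>v\<in>V. w v * of_bool (y \<in> S v \<and> x \<notin> S v)) \<le> max 0 (pmf D y - pmf D x)"
    proof (cases "pmf D x \<le> pmf D y")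
      case True
      have "(\<Sum>v\<in>V. w v * of_bool (y \<in> S v \<and> x \<notin> S v)) = pmf D y - pmf D x"
        unfolding lcS[OF yx(1)] lcS[OF x] sum_subtractf[symmetric]
        using True x yx(1) by (intro sum.cong) (auto simp: S_def)
      then show ?thesis by simp
    next
      case False
      then have "(\<Sum>v\<in>V. w v * of_bool (y \<in> S v \<and> x \<notin> S v)) = 0"
        using x by (intro sum.neutral) (auto simp: S_def)
      then show ?thesis by simp
    qed
  qed simp
  finally show ?thesis .
qed

section \<open>The tester\<close>

text \<open>The continuation \<open>K\<close> stands in for sequential composition: it receives the
  number of answers equal to \<open>y\<close>.\<close>

primrec tally :: "nat set \<Rightarrow> nat \<Rightarrow> nat \<Rightarrow> (nat \<Rightarrow> 'r cond_alg) \<Rightarrow> 'r cond_alg" where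
  "tally S y 0 K = K 0"
| "tally S y (Suc m) K = Query S (\<lambda>i. tally S y m (\<lambda>c. K ((if i = y then 1 else 0) + c)))"

text \<open>
  The case \<open>y \<le> 1\<close> is separate because \<open>pmf_of_set {}\<close> is unspecified.
\<close>

primrec tester :: "nat \<Rightarrow> nat \<Rightarrow> real \<Rightarrow> nat \<Rightarrow> verdict cond_alg" where
  "tester n m \<theta> 0 = Return ACCEPT"
| "tester n m \<theta> (Suc N) = Query {1..n} (\<lambda>y. if y \<le> 1 then tester n m \<theta> N
     else Coins (pmf_of_set {1..<y}) (\<lambda>x. tally {x, y} y m (\<lambda>c.
       if \<theta> < real c then Return REJECT else tester n m \<theta> N)))"

section \<open>Admissibility and number of oracle calls\<close>

lemma legal_tally:
  assumes "S \<subseteq> {1..n}" "measure_pmf.prob D S > 0" "\<And>c. legal n D (K c)"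
  shows "legal n D (tally S y m K)"
  using assms by (induction m arbitrary: K) auto

lemma queries_tally:
  assumes "\<And>c. queries D (K c) \<le> enat b"
  shows "queries D (tally S y m K) \<le> enat (m + b)"
  using assms
proof (induction m arbitrary: K)
  case (Suc m)
  then have "(SUP i\<in>S \<inter> set_pmf D. queries D (tally S y m (\<lambda>c. K ((if i = y then 1 else 0) + c))))
      \<le> enat (m + b)" by (intro SUP_least) auto
  then show ?case by (simp add: eSuc_enat[symmetric])
qed simp

lemma prob_pos_iff: "measure_pmf.prob D S > 0 \<longleftrightarrow> set_pmf D \<inter> S \<noteq> {}"
  using measure_pmf_zero_iff[of D S] by (simp add: zero_less_measure_iff)

lemma legal_tester:
  assumes "D \<in> distributions n"
  shows "legal n D (tester n m \<theta> N)"
proof (induction N)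
  case (Suc N)
  have "set_pmf D \<noteq> {}" by (rule set_pmf_not_empty)
  then have "measure_pmf.prob D {1..n} > 0"
    using assms unfolding prob_pos_iff distributions_def by (auto simp: Int_absorb2)
  \<comment> \<open>Since y was an oracle answer, it has positive mass, hence so has the pair even
    if D x = 0.\<close>
  moreover have "legal n D (tally {x, y} y m (\<lambda>c.
       if \<theta> < real c then Return REJECT else tester n m \<theta> N))"
    if "y \<in> {1..n} \<inter> set_pmf D" "x \<in> {1..<y}" for x y
    using that Suc by (intro legal_tally) (auto simp: prob_pos_iff)
  ultimately show ?case using Suc by (auto simp: set_pmf_of_set)
qed simp

lemma queries_tester: "queries D (tester n m \<theta> N) \<le> enat (N * (m + 1))"
proof (induction N)
  case (Suc N)
  have "queries D (tally {x, y} y m (\<lambda>c. if \<theta> < real c then Return REJECT else tester n m \<theta> N))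
      \<le> enat (m + N * (m + 1))" for x y
    using Suc by (intro queries_tally) (auto simp: enat_0[symmetric] simp del: mult_Suc_right)
  moreover have "queries D (tester n m \<theta> N) \<le> enat (m + N * (m + 1))"
    using Suc by (rule order_trans) simp
  ultimately have "(SUP y\<in>{1..n} \<inter> set_pmf D. queries D (if y \<le> 1 then tester n m \<theta> N
     else Coins (pmf_of_set {1..<y}) (\<lambda>x. tally {x, y} y m (\<lambda>c.
       if \<theta> < real c then Return REJECT else tester n m \<theta> N)))) \<le> enat (m + N * (m + 1))"
    by (intro SUP_least) (auto intro!: SUP_least)
  then have "queries D (tester n m \<theta> (Suc N)) \<le> eSuc (enat (m + N * (m + 1)))"
    by simp
  then show ?case by (simp add: eSuc_enat algebra_simps)
qed simp

section \<open>Output distribution of the tester\<close>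

lemma map_pmf_eq_bernoulli: "map_pmf (\<lambda>i. i = y) p = bernoulli_pmf (pmf p y)"
proof (rule pmf_eqI)
  fix b
  have *: "pmf (map_pmf (\<lambda>i. i = y) p) True = pmf p y"
    by (simp add: pmf_map vimage_def pmf.rep_eq)
  then show "pmf (map_pmf (\<lambda>i. i = y) p) b = pmf (bernoulli_pmf (pmf p y)) b"
    using pmf_False_conv_True[of "map_pmf (\<lambda>i. i = y) p"]
    by (cases b) (simp_all add: pmf_le_1)
qed

text \<open>Whether an answer equals \<open>y\<close> is a Bernoulli variable, independent from call
  to call, so the count is binomial.\<close>

lemma run_tally:
  "run D (tally S y m K) = bind_pmf (binomial_pmf m (pmf (cond_pmf D S) y)) (\<lambda>c. run D (K c))"
proof (induction m arbitrary: K)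
  case 0
  then show ?case by (simp add: binomial_pmf_0 bind_return_pmf pmf_le_1)
next
  case (Suc m)
  let ?p = "pmf (cond_pmf D S) y"
  have "run D (tally S y (Suc m) K) = bind_pmf (map_pmf (\<lambda>i. i = y) (cond_pmf D S))
      (\<lambda>b. bind_pmf (binomial_pmf m ?p) (\<lambda>c. run D (K ((if b then 1 else 0) + c))))"
    by (simp add: Suc bind_map_pmf)
  then show ?case
    by (simp add: map_pmf_eq_bernoulli binomial_pmf_Suc pmf_le_1 bind_assoc_pmf bind_return_pmf)
qed

text \<open>One round of \<open>tester\<close>, with \<open>True\<close> for rejection. The binomial
  parameter is the chance that a call on \<open>{x, y}\<close> returns \<open>y\<close>.\<close>

definition trial :: "nat pmf \<Rightarrow> nat \<Rightarrow> real \<Rightarrow> bool pmf" where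
  "trial D m \<theta> = bind_pmf D (\<lambda>y. if y \<le> 1 then return_pmf False
     else bind_pmf (pmf_of_set {1..<y}) (\<lambda>x.
       map_pmf (\<lambda>c. \<theta> < real c) (binomial_pmf m (pmf D y / (pmf D x + pmf D y)))))"

lemma run_tester_Suc:
  assumes "D \<in> distributions n"
  shows "run D (tester n m \<theta> (Suc N))
    = bind_pmf (trial D m \<theta>) (\<lambda>r. if r then return_pmf REJECT else run D (tester n m \<theta> N))"
proof -
  \<comment> \<open>The call on the whole domain is a plain sample from D.\<close>
  have all: "cond_pmf D {1..n} = D"
  proof (rule pmf_eqI)
    fix i
    have s: "set_pmf D \<subseteq> {1..n}" using assms by (simp add: distributions_def)
    then have "set_pmf D \<inter> {1..n} \<noteq> {}" using set_pmf_not_empty[of D] by (simp add: Int_absorb2)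
    moreover have "measure_pmf.prob D {1..n} = 1"
      using s by (subst measure_pmf.prob_eq_1) (auto simp: AE_measure_pmf_iff)
    ultimately show "pmf (cond_pmf D {1..n}) i = pmf D i"
      using s by (auto simp: pmf_cond set_pmf_iff)
  qed
  have *: "pmf (cond_pmf D {x, y}) y = pmf D y / (pmf D x + pmf D y)"
    if "y \<in> set_pmf D" "x \<in> {1..<y}" for x y
    using that by (subst pmf_cond) (auto simp: measure_measure_pmf_finite)
  show ?thesis unfolding trial_def bind_assoc_pmf
    by (auto simp: all[simplified] bind_return_pmf bind_map_pmf bind_assoc_pmf run_tally *
        set_pmf_of_set intro!: bind_pmf_cong)
qed

text \<open>The rounds are independent, and acceptance means that none of them rejects.\<close>

lemma pmf_run_tester_ACCEPT:
  assumes "D \<in> distributions n"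
  shows "pmf (run D (tester n m \<theta> N)) ACCEPT = (1 - pmf (trial D m \<theta>) True) ^ N"
proof (induction N)
  case (Suc N)
  show ?case unfolding run_tester_Suc[OF assms] pmf_bind
    by (subst integral_measure_pmf_real[of UNIV])
      (auto simp: UNIV_bool Suc pmf_False_conv_True)
qed simp

lemma pmf_verdict_REJECT: "pmf p REJECT = 1 - pmf p ACCEPT"
proof -
  have "(\<Sum>v\<in>{ACCEPT, REJECT}. pmf p v) = 1"
    by (intro sum_pmf_eq_1) (auto intro: verdict.exhaust)
  then show ?thesis by simp
qed

section \<open>Rejection probability of one trial\<close>

lemma pmf_trial:
  assumes "D \<in> distributions n"
  shows "pmf (trial D m \<theta>) True = (\<Sum>y\<in>{1..n}. \<Sum>x\<in>{1..<y}. pmf D y *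
    measure_pmf.prob (binomial_pmf m (pmf D y / (pmf D x + pmf D y))) {c. \<theta> < real c} / real (y - 1))"
proof -
  let ?f = "\<lambda>y x. measure_pmf.prob (binomial_pmf m (pmf D y / (pmf D x + pmf D y))) {c. \<theta> < real c}"
  have "pmf (trial D m \<theta>) True = (\<Sum>y\<in>{1..n}. (\<Sum>x\<in>{1..<y}. ?f y x) / real (y - 1) * pmf D y)"
    unfolding trial_def pmf_bind
    using assms
    by (subst integral_measure_pmf_real[of "{1..n}"])
      (auto simp: distributions_def pmf_bind_pmf_of_set pmf_map vimage_def intro!: sum.cong)
  also have "\<dots> = (\<Sum>y\<in>{1..n}. \<Sum>x\<in>{1..<y}. pmf D y * ?f y x / real (y - 1))"
    unfolding sum_distrib_right sum_divide_distrib by (simp add: mult.commute)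
  finally show ?thesis .
qed

text \<open>For every compared pair the binomial parameter is at most 1/2, so rejection is an upward
  deviation by \<open>d\<close>, bounded by Hoeffding.\<close>

lemma pmf_trial_le:
  assumes D: "D \<in> monotone_distributions n" and m: "0 < m" and d: "0 \<le> d"
  shows "pmf (trial D m (m * (1 / 2 + d))) True \<le> exp (-2 * real m * d\<^sup>2)"
proof -
  have D': "D \<in> distributions n" using D by (simp add: monotone_distributions_def)
  have tail: "measure_pmf.prob (binomial_pmf m (pmf D y / (pmf D x + pmf D y)))
      {c. m * (1 / 2 + d) < real c} \<le> exp (-2 * real m * d\<^sup>2)"
    if "y \<in> {1..n}" "x \<in> {1..<y}" for x y
  proof -
    define p where "p = pmf D y / (pmf D x + pmf D y)"
    have "pmf D y \<le> pmf D x" using D that by (auto simp: monotone_distributions_def)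
    \<comment> \<open>If both masses vanish, \<open>p\<close> is 0 by division by zero.\<close>
    then have p_half: "0 \<le> p" "p \<le> 1 / 2" unfolding p_def
      using pmf_nonneg[of D x] pmf_nonneg[of D y]
      by (auto simp: divide_simps add_nonneg_eq_0_iff not_less simp del: pmf_nonneg)
    interpret binomial_distribution m p by unfold_locales (use p_half in auto)
    have "measure_pmf.prob (binomial_pmf m p) {c. m * (1 / 2 + d) < real c}
        \<le> measure_pmf.prob (binomial_pmf m p) {c. c / m \<ge> p + d}"
    proof (intro measure_pmf.finite_measure_mono subsetI)
      fix c assume "c \<in> {c. m * (1 / 2 + d) < real c}"
      then have "1 / 2 + d < real c / m" using m by (simp add: field_simps)
      then show "c \<in> {c. c / m \<ge> p + d}" using p_half by simp
    qed simp
    also have "\<dots> \<le> exp (-2 * real m * d\<^sup>2)" using prob_ge'[OF m d] by simp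
    finally show ?thesis by (simp add: p_def)
  qed
  have "pmf (trial D m (m * (1 / 2 + d))) True
      \<le> (\<Sum>y\<in>{1..n}. \<Sum>x\<in>{1..<y}. pmf D y * exp (-2 * real m * d\<^sup>2) / real (y - 1))"
    unfolding pmf_trial[OF D']
    by (intro sum_mono divide_right_mono mult_left_mono tail) auto
  \<comment> \<open>The inner sum averages a constant, except for y = 1, where it is empty.\<close>
  also have "\<dots> \<le> (\<Sum>y\<in>{1..n}. pmf D y * exp (-2 * real m * d\<^sup>2))"
    by (intro sum_mono) simp
  also have "\<dots> = exp (-2 * real m * d\<^sup>2)"
    using sum_pmf_distributions[OF D'] by (simp add: sum_distrib_right[symmetric])
  finally show ?thesis .
qed

text \<open>Pairs with D y - D x > 8 d D y are rejected with probability at least 1/2; ignoring all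
  others costs at most 8 d in \<open>violation_mass\<close>.\<close>

lemma pmf_trial_ge:
  assumes D: "D \<in> distributions n" and m: "0 < m" and d: "0 < d"
    and small: "exp (-2 * real m * d\<^sup>2) \<le> 1 / 2"
  shows "(violation_mass n D - 8 * d) / 2 \<le> pmf (trial D m (m * (1 / 2 + d))) True"
proof -
  have tail: "(max 0 (pmf D y - pmf D x) - 8 * d * pmf D y) / 2 \<le> pmf D y *
      measure_pmf.prob (binomial_pmf m (pmf D y / (pmf D x + pmf D y))) {c. m * (1 / 2 + d) < real c}"
    for x y
  proof (cases "8 * d * pmf D y < pmf D y - pmf D x")
    case False
    then have "(max 0 (pmf D y - pmf D x) - 8 * d * pmf D y) / 2 \<le> 0"
      using d by auto
    also have "0 \<le> pmf D y *
      measure_pmf.prob (binomial_pmf m (pmf D y / (pmf D x + pmf D y))) {c. m * (1 / 2 + d) < real c}"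
      by simp
    finally show ?thesis .
  next
    case True
    define p where "p = pmf D y / (pmf D x + pmf D y)"
    have y: "0 < pmf D y" using True d pmf_nonneg[of D y] pmf_nonneg[of D x]
      by (cases "pmf D y = 0") auto
    then have s: "0 < pmf D x + pmf D y" by (simp add: add_nonneg_pos)
    \<comment> \<open>Origin of the 8: by D x <= D y, the term 2 d (D x + D y) is at most 4 d D y,
      which is below (D y - D x) / 2.\<close>
    have "(1 / 2 + 2 * d) * (pmf D x + pmf D y) \<le> pmf D y"
    proof -
      have "pmf D x \<le> pmf D y" using True d y by (smt (verit) mult_pos_pos)
      then have "d * pmf D x \<le> d * pmf D y" using d by simp
      then show ?thesis using True by (simp add: algebra_simps)
    qed
    then have p2: "1 / 2 + 2 * d \<le> p" unfolding p_def using s by (simp add: field_simps)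
    have p: "0 \<le> p" "p \<le> 1" unfolding p_def using s by auto
    interpret binomial_distribution m p by unfold_locales (use p in auto)
    \<comment> \<open>The threshold lies at least \<open>d\<close> below \<open>p\<close>, so
      missing it is a downward deviation by \<open>d\<close>.\<close>
    have "1 - measure_pmf.prob (binomial_pmf m p) {c. m * (1 / 2 + d) < real c}
        = measure_pmf.prob (binomial_pmf m p) (UNIV - {c. m * (1 / 2 + d) < real c})"
      by (subst measure_pmf.prob_compl[symmetric]) auto
    also have "\<dots> \<le> measure_pmf.prob (binomial_pmf m p) {c. c / m \<le> p - d}"
    proof (intro measure_pmf.finite_measure_mono subsetI)
      fix c assume "c \<in> UNIV - {c. m * (1 / 2 + d) < real c}"
      then have "real c / m \<le> 1 / 2 + d" using m by (simp add: field_simps)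
      then show "c \<in> {c. c / m \<le> p - d}" using p2 by simp
    qed simp
    also have "\<dots> \<le> exp (-2 * real m * d\<^sup>2)" using prob_le'[OF m less_imp_le[OF d]] by simp
    finally have "1 / 2 \<le> measure_pmf.prob (binomial_pmf m p) {c. m * (1 / 2 + d) < real c}"
      using small by simp
    then have "pmf D y * (1 / 2) \<le>
        pmf D y * measure_pmf.prob (binomial_pmf m p) {c. m * (1 / 2 + d) < real c}"
      by (intro mult_left_mono) auto
    moreover have "(max 0 (pmf D y - pmf D x) - 8 * d * pmf D y) / 2 \<le> pmf D y * (1 / 2)"
    proof -
      have "0 < 8 * d * pmf D y" using d y by simp
      moreover have "max 0 (pmf D y - pmf D x) \<le> pmf D y" using y by simp
      moreover have "(a - b) / 2 \<le> c * (1 / 2)" if "0 < b" "a \<le> c" for a b c :: real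
        using that by simp
      ultimately show ?thesis by blast
    qed
    ultimately show ?thesis by (simp add: p_def)
  qed
  have "violation_mass n D - 8 * d = violation_mass n D - (\<Sum>y\<in>{1..n}. 8 * d * pmf D y)"
    using sum_pmf_distributions[OF D] by (simp add: sum_distrib_left[symmetric])
  also have "\<dots> \<le> violation_mass n D - (\<Sum>y\<in>{1..n}. \<Sum>x\<in>{1..<y}. 8 * d * pmf D y / real (y - 1))"
    using d by (intro diff_left_mono sum_mono) simp
  also have "\<dots> = (\<Sum>y\<in>{1..n}. \<Sum>x\<in>{1..<y}.
      (max 0 (pmf D y - pmf D x) - 8 * d * pmf D y) / real (y - 1))"
    unfolding violation_mass_def sum_subtractf[symmetric] diff_divide_distrib ..
  finally have "(violation_mass n D - 8 * d) / 2 \<le> (\<Sum>y\<in>{1..n}. \<Sum>x\<in>{1..<y}.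
      (max 0 (pmf D y - pmf D x) - 8 * d * pmf D y) / real (y - 1)) / 2"
    by simp
  also have "\<dots> = (\<Sum>y\<in>{1..n}. \<Sum>x\<in>{1..<y}.
      (max 0 (pmf D y - pmf D x) - 8 * d * pmf D y) / 2 / real (y - 1))"
    unfolding sum_divide_distrib by (simp only: divide_divide_eq_left mult.commute)
  also have "\<dots> \<le> pmf (trial D m (m * (1 / 2 + d))) True"
    unfolding pmf_trial[OF D] by (intro sum_mono divide_right_mono tail) auto
  finally show ?thesis .
qed

section \<open>Parameters and error probabilities\<close>

text \<open>A trial on a far distribution rejects with probability at least \<epsilon>^2 / 8, so the
  expected number of rejections in this many independent trials is at least 2.\<close>

definition trials :: "real \<Rightarrow> nat" where
  "trials \<epsilon> = nat \<lceil>16 / \<epsilon>\<^sup>2\<rceil>"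

text \<open>
  Since 26112 = 51 * 512, a trial on a monotone distribution rejects with probability at most
  \<open>\<epsilon>\<^sup>2 / 51\<close>, and there are at most \<open>17 / \<epsilon>\<^sup>2\<close> trials.
\<close>

definition comparisons :: "real \<Rightarrow> nat" where
  "comparisons \<epsilon> = nat \<lceil>26112 / \<epsilon> ^ 6\<rceil>"

text \<open>The margin d = \<epsilon>^2 / 32 makes the loss 8 d half of the lower bound \<epsilon>^2
  / 2 on \<open>violation_mass\<close>.\<close>

definition monotonicity_tester :: "nat \<Rightarrow> real \<Rightarrow> verdict cond_alg" where
  "monotonicity_tester n \<epsilon> = tester n (comparisons \<epsilon>)
     (comparisons \<epsilon> * (1 / 2 + \<epsilon>\<^sup>2 / 32)) (trials \<epsilon>)"

lemma trials_bounds: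
  assumes "\<epsilon> \<in> {0<..1}"
  shows "16 / \<epsilon>\<^sup>2 \<le> trials \<epsilon>" "trials \<epsilon> \<le> 17 / \<epsilon>\<^sup>2"
proof -
  \<comment> \<open>As \<epsilon> <= 1, rounding up costs at most one further 1 /
    \<epsilon>^2.\<close>
  have "1 \<le> 1 / \<epsilon>\<^sup>2" using assms by (simp add: power_le_one)
  moreover have "real (trials \<epsilon>) = of_int \<lceil>16 / \<epsilon>\<^sup>2\<rceil>" using assms by (simp add: trials_def)
  ultimately show "16 / \<epsilon>\<^sup>2 \<le> trials \<epsilon>" "trials \<epsilon> \<le> 17 / \<epsilon>\<^sup>2"
    using ceiling_correct[of "16 / \<epsilon>\<^sup>2"] by auto
qed

lemma comparisons_bounds:
  assumes "\<epsilon> \<in> {0<..1}"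
  shows "26112 / \<epsilon> ^ 6 \<le> comparisons \<epsilon>" "comparisons \<epsilon> \<le> 26113 / \<epsilon> ^ 6"
proof -
  have "1 \<le> 1 / \<epsilon> ^ 6" using assms by (simp add: power_le_one)
  moreover have "real (comparisons \<epsilon>) = of_int \<lceil>26112 / \<epsilon> ^ 6\<rceil>"
    using assms by (simp add: comparisons_def)
  ultimately show "26112 / \<epsilon> ^ 6 \<le> comparisons \<epsilon>" "comparisons \<epsilon> \<le> 26113 / \<epsilon> ^ 6"
    using ceiling_correct[of "26112 / \<epsilon> ^ 6"] by auto
qed

text \<open>The crude bound exp (-z) <= 1 / z is enough; it is why \<open>comparisons\<close> has
  order 1 / \<epsilon>^6 instead of log (1 / \<epsilon>) / \<epsilon>^4.\<close>

lemma comparisons_exp: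
  assumes "\<epsilon> \<in> {0<..1}"
  shows "exp (-2 * real (comparisons \<epsilon>) * (\<epsilon>\<^sup>2 / 32)\<^sup>2) \<le> \<epsilon>\<^sup>2 / 51"
proof -
  have e: "0 < \<epsilon>" using assms by simp
  have "51 / \<epsilon>\<^sup>2 = 2 * (26112 / \<epsilon> ^ 6) * (\<epsilon>\<^sup>2 / 32)\<^sup>2"
    using e by (simp add: field_simps flip: power_add power_mult)
  also have "\<dots> \<le> 2 * comparisons \<epsilon> * (\<epsilon>\<^sup>2 / 32)\<^sup>2"
    using comparisons_bounds[OF assms] by (intro mult_right_mono) auto
  also have "\<dots> \<le> exp (2 * comparisons \<epsilon> * (\<epsilon>\<^sup>2 / 32)\<^sup>2)"
    using exp_ge_add_one_self[of "2 * comparisons \<epsilon> * (\<epsilon>\<^sup>2 / 32)\<^sup>2"] by linarith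
  finally have "inverse (exp (2 * comparisons \<epsilon> * (\<epsilon>\<^sup>2 / 32)\<^sup>2)) \<le> inverse (51 / \<epsilon>\<^sup>2)"
    using e by (intro le_imp_inverse_le) auto
  then show ?thesis by (simp add: exp_minus)
qed

lemma monotonicity_tester_accepts:
  assumes e: "\<epsilon> \<in> {0<..1}" and D: "D \<in> monotone_distributions n"
  shows "2 / 3 \<le> pmf (run D (monotonicity_tester n \<epsilon>)) ACCEPT"
proof -
  have D': "D \<in> distributions n" using D by (simp add: monotone_distributions_def)
  have "0 < 26112 / \<epsilon> ^ 6" using e by simp
  then have m: "0 < comparisons \<epsilon>" using comparisons_bounds[OF e] by linarith
  define r where "r = pmf (trial D (comparisons \<epsilon>) (comparisons \<epsilon> * (1 / 2 + \<epsilon>\<^sup>2 / 32))) True"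
  have r: "r \<le> \<epsilon>\<^sup>2 / 51"
    using pmf_trial_le[OF D m, of "\<epsilon>\<^sup>2 / 32"] comparisons_exp[OF e] by (simp add: r_def)
  have "trials \<epsilon> * r \<le> 17 / \<epsilon>\<^sup>2 * (\<epsilon>\<^sup>2 / 51)"
    using trials_bounds[OF e] r by (intro mult_mono) (auto simp: r_def)
  also have "\<dots> = 1 / 3" using e by simp
  finally have "2 / 3 \<le> 1 + trials \<epsilon> * (- r)" by simp
  \<comment> \<open>Bernoulli's inequality acts as the union bound over the trials.\<close>
  also have "\<dots> \<le> (1 + (- r)) ^ trials \<epsilon>"
    by (intro Bernoulli_inequality) (simp add: r_def pmf_le_1)
  finally show ?thesis by (simp add: monotonicity_tester_def pmf_run_tester_ACCEPT[OF D'] r_def)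
qed

lemma monotonicity_tester_rejects:
  assumes e: "\<epsilon> \<in> {0<..1}" and D: "D \<in> distributions n"
    and far: "\<epsilon> \<le> d_TV_class n D (monotone_distributions n)"
  shows "2 / 3 \<le> pmf (run D (monotonicity_tester n \<epsilon>)) REJECT"
proof -
  have "0 < 26112 / \<epsilon> ^ 6" using e by simp
  then have m: "0 < comparisons \<epsilon>" using comparisons_bounds[OF e] by linarith
  define r where "r = pmf (trial D (comparisons \<epsilon>) (comparisons \<epsilon> * (1 / 2 + \<epsilon>\<^sup>2 / 32))) True"
  have "\<epsilon>\<^sup>2 \<le> 1" using e by (simp add: power_le_one)
  then have "\<epsilon>\<^sup>2 / 51 \<le> 1 / 2" by simp
  then have "(violation_mass n D - 8 * (\<epsilon>\<^sup>2 / 32)) / 2 \<le> r" unfolding r_def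
    using comparisons_exp[OF e] e by (intro pmf_trial_ge[OF D m]) auto
  \<comment> \<open>Half of \<epsilon>^2 / 2 - \<epsilon>^2 / 4.\<close>
  then have r: "\<epsilon>\<^sup>2 / 8 \<le> r" using violation_mass_ge[OF D _ far] e by simp
  have "2 = 16 / \<epsilon>\<^sup>2 * (\<epsilon>\<^sup>2 / 8)" using e by simp
  also have "\<dots> \<le> trials \<epsilon> * r" using trials_bounds[OF e] r by (intro mult_mono) auto
  finally have Nr: "2 \<le> trials \<epsilon> * r" .
  have "(1 - r) ^ trials \<epsilon> \<le> exp (- r) ^ trials \<epsilon>"
    using exp_ge_add_one_self[of "- r"] by (intro power_mono) (auto simp: r_def pmf_le_1)
  also have "\<dots> = exp (- (trials \<epsilon> * r))" by (simp add: exp_of_nat_mult[symmetric])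
  also have "\<dots> \<le> exp (- 2)" using Nr by simp
  \<comment> \<open>From exp 2 >= 1 + 2.\<close>
  also have "\<dots> \<le> 1 / 3"
    using exp_ge_add_one_self[of "2::real"] by (simp add: exp_minus field_simps)
  finally show ?thesis
    by (simp add: monotonicity_tester_def pmf_verdict_REJECT pmf_run_tester_ACCEPT[OF D] r_def)
qed

text \<open>The count is in fact O(1 / \<epsilon>^8) without logarithms, hence the exponent 0; the
  constant is 17 * 26114.\<close>

lemma query_bound_soft_O:
  "(\<lambda>\<epsilon>. real (trials \<epsilon> * (comparisons \<epsilon> + 1))) \<in> soft_O {0<..1} (\<lambda>\<epsilon>. 1 / \<epsilon> ^ 22)"
proof -
  have "\<bar>real (trials \<epsilon> * (comparisons \<epsilon> + 1))\<bar> \<le> 443938 * (1 / \<epsilon> ^ 22) * ln (2 + 1 / \<epsilon> ^ 22) ^ 0"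
    if e: "\<epsilon> \<in> {0<..1}" for \<epsilon> :: real
  proof -
    have "1 \<le> 1 / \<epsilon> ^ 6" using e by (simp add: power_le_one)
    then have "real (comparisons \<epsilon>) + 1 \<le> 26114 / \<epsilon> ^ 6"
      using comparisons_bounds(2)[OF e] by simp
    then have "real (trials \<epsilon>) * (real (comparisons \<epsilon>) + 1) \<le> 17 / \<epsilon>\<^sup>2 * (26114 / \<epsilon> ^ 6)"
      using trials_bounds(2)[OF e] by (intro mult_mono) auto
    also have "\<dots> = 443938 * (1 / \<epsilon> ^ 8)" by (simp flip: power_add)
    also have "\<dots> \<le> 443938 * (1 / \<epsilon> ^ 22)"
      using e by (intro mult_left_mono divide_left_mono power_decreasing) auto
    finally show ?thesis by (simp add: algebra_simps)
  qed
  then show ?thesis unfolding soft_O_def by blast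
qed

theorem theorem4p1:
  "\<exists>(A :: nat \<Rightarrow> real \<Rightarrow> verdict cond_alg) (q :: real \<Rightarrow> nat).
     (\<lambda>\<epsilon>. real (q \<epsilon>)) \<in> soft_O {0<..1} (\<lambda>\<epsilon>. 1 / \<epsilon> ^ 22) \<and>
     (\<forall>n. \<forall>\<epsilon>\<in>{0<..1}. \<forall>D\<in>distributions n.
        legal n D (A n \<epsilon>) \<and>
        queries D (A n \<epsilon>) \<le> enat (q \<epsilon>) \<and>
        (D \<in> monotone_distributions n \<longrightarrow> pmf (run D (A n \<epsilon>)) ACCEPT \<ge> 2 / 3) \<and>
        (d_TV_class n D (monotone_distributions n) \<ge> \<epsilon> \<longrightarrow> pmf (run D (A n \<epsilon>)) REJECT \<ge> 2 / 3))"
proof (intro exI[of _ monotonicity_tester] exI[of _ "\<lambda>\<epsilon>. trials \<epsilon> * (comparisons \<epsilon> + 1)"]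
    conjI allI ballI impI)
  fix n \<epsilon> D
  assume "\<epsilon> \<in> {0<..1::real}" and "D \<in> distributions n"
  then show "legal n D (monotonicity_tester n \<epsilon>)"
    and "queries D (monotonicity_tester n \<epsilon>) \<le> enat (trials \<epsilon> * (comparisons \<epsilon> + 1))"
    unfolding monotonicity_tester_def by (simp_all only: legal_tester queries_tester)
qed (use query_bound_soft_O monotonicity_tester_accepts monotonicity_tester_rejects in auto)

end
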